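(* Let $\alpha,\delta\in(0,1)$. Consider the online one-sided Gaussian mixture model $\mathbf P_{\pi_1,F_1}$ and the LORD procedure at level $\alpha$ with $W_0\in(0,\alpha)$ and spending sequence $\gamma_k=\frac{z}{k(\log(k\vee2))^\gamma}$, $k\ge1$, for some $\gamma>1$, where $z>0$ is the constant such that $\sum_{k\ge1}\gamma_k=1$. Let $R(k)$ be its number of rejections up to time $k$, and for $k\ge1$ $$\overline{\mathrm{FDP}}^{\mathrm{Freed}}_{\alpha,k}=1\wedge\left(\alpha+\frac{\Delta(\alpha(1\vee R(k)))}{1\vee R(k)}\right),\qquad \overline{\mathrm{FDP}}^{\mathrm{KR\text{-}U}}_{\alpha,k}=1\wedge\min_{a\ge1}\left\{\frac{\log(1/\delta_a)}{a\log(1+\log(1/\delta_a)/a)}\left(\alpha+\frac a{1\vee R(k)}\right)\right\}$$ (minimum over integers $a$). Then both envelopes are consistent in the sense that, for $\overline{\mathrm{FDP}}_{\alpha,k}$ equal to either of them and all $\epsilon>0$, $$\lim_{k\to\infty}\mathbf P_{\pi_1,F_1}\bigl(\overline{\mathrm{FDP}}_{\alpha,k}-\alpha\ge\epsilon\bigr)=0.$$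
   Context: Model $\mathbf P_{\pi_1,F_1}$: $(p_k,H_k)\in[0,1]\times\{0,1\}$, $k\ge1$, are i.i.d. with $\mathbf P(H_k=1)=\pi_1$ for a fixed $\pi_1\in(0,1)$, $p_k\mid H_k=0\sim U(0,1)$, and $p_k\mid H_k=1\sim F_1$ with $F_1(x)=\overline\Phi(\overline\Phi^{-1}(x)-\mu)$, $x\in[0,1]$, for some $\mu>0$, where $\overline\Phi$ is the upper tail function of $\mathcal N(0,1)$. The LORD procedure rejects at time $k$ if $p_k\le\alpha_k$, where $\alpha_k=W_0\gamma_k+(\alpha-W_0)\gamma_{k-\tau_1}+\alpha\sum_{j\ge2}\gamma_{k-\tau_j}$, $\tau_j$ is the first time with $j$ rejections ($+\infty$ if it never occurs), and $\gamma_k=0$ for $k\le0$. $R(k)=\sum_{i=1}^k\mathbf 1\{p_i\le\alpha_i\}$. Notation: $\kappa=\pi^2/6$, $\delta_a=\delta/(\kappa a^2)$, $\Delta(u)=2\sqrt{\varepsilon_u}\sqrt{u\vee1}+\frac12\varepsilon_u$ with $\varepsilon_u=\log((1+\kappa)/\delta)+2\log(1+\log_2(u\vee1))$. *)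

theory Defs
  imports "HOL-Probability.Probability" "HOL-Library.Extended_Nat"
begin

text \<open>All sequences are indexed by times \<open>k \<ge> 1\<close>; values at \<open>k = 0\<close> are never used.\<close>

subsection \<open>The online mixture model\<close>

text \<open>Identical distribution of the pairs is not listed separately: the three distributional
  axioms determine the law of \<open>(p k, H k)\<close> and do not depend on \<open>k\<close>.\<close>

locale online_mixture = prob_space M
  for M :: "'a measure" +
  fixes p :: "nat \<Rightarrow> 'a \<Rightarrow> real" and H :: "nat \<Rightarrow> 'a \<Rightarrow> nat"
    and \<pi>1 :: real and F1 :: "real \<Rightarrow> real"
  assumes p_range: "\<And>k \<omega>. k \<ge> 1 \<Longrightarrow> \<omega> \<in> space M \<Longrightarrow> p k \<omega> \<in> {0..1}"
    and H_range: "\<And>k \<omega>. k \<ge> 1 \<Longrightarrow> \<omega> \<in> space M \<Longrightarrow> H k \<omega> \<in> {0, 1}"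
    and indep: "indep_vars (\<lambda>_. borel \<Otimes>\<^sub>M count_space UNIV) (\<lambda>k \<omega>. (p k \<omega>, H k \<omega>)) {1..}"
    and prob_H: "\<And>k. k \<ge> 1 \<Longrightarrow> \<P>(\<omega> in M. H k \<omega> = 1) = \<pi>1"
    and null_law: "\<And>k x. k \<ge> 1 \<Longrightarrow> x \<in> {0..1} \<Longrightarrow>
      \<P>(\<omega> in M. p k \<omega> \<le> x \<bar> H k \<omega> = 0) = x"
    and alt_law: "\<And>k x. k \<ge> 1 \<Longrightarrow> x \<in> {0..1} \<Longrightarrow>
      \<P>(\<omega> in M. p k \<omega> \<le> x \<bar> H k \<omega> = 1) = F1 x"

definition Phi_bar :: "real \<Rightarrow> real" where
  "Phi_bar x = measure std_normal_distribution {x<..}"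

text \<open>The endpoint values are the limits given by \<open>Phi_bar\<^sup>-\<^sup>1 0 = \<infinity>\<close> and
  \<open>Phi_bar\<^sup>-\<^sup>1 1 = -\<infinity>\<close>.\<close>

definition gaussian_alt_cdf :: "real \<Rightarrow> real \<Rightarrow> real" where
  "gaussian_alt_cdf \<mu> x =
     (if x \<le> 0 then 0 else if x \<ge> 1 then 1 else Phi_bar (inv Phi_bar x - \<mu>))"

subsection \<open>The LORD procedure\<close>

definition num_rejections :: "(nat \<Rightarrow> bool) \<Rightarrow> nat \<Rightarrow> nat" where
  "num_rejections rej k = card {i \<in> {1..k}. rej i}"

text \<open>The infimum of the empty set of type \<^typ>\<open>enat\<close> is \<open>\<infinity>\<close>.\<close>

definition rejection_time :: "(nat \<Rightarrow> bool) \<Rightarrow> nat \<Rightarrow> enat" where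
  "rejection_time rej j = (INF k\<in>{k. num_rejections rej k = j}. enat k)"

text \<open>\<open>lagged g k t\<close> is \<open>g (k - t)\<close> under the convention \<open>g i = 0\<close> for \<open>i \<le> 0\<close>.\<close>

definition lagged :: "(nat \<Rightarrow> real) \<Rightarrow> nat \<Rightarrow> enat \<Rightarrow> real" where
  "lagged g k t = (case t of enat n \<Rightarrow> if n < k then g (k - n) else 0 | \<infinity> \<Rightarrow> 0)"

definition lord_formula :: "real \<Rightarrow> real \<Rightarrow> (nat \<Rightarrow> real) \<Rightarrow> (nat \<Rightarrow> bool) \<Rightarrow> nat \<Rightarrow> real" where
  "lord_formula \<alpha> W0 g rej k =
     W0 * g k + (\<alpha> - W0) * lagged g k (rejection_time rej 1)
     + \<alpha> * (\<Sum>\<^sub>\<infinity>j\<in>{2..}. lagged g k (rejection_time rej j))"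

text \<open>The guard \<open>i < k\<close> only makes the recursion well-founded: rejections at times \<open>\<ge> k\<close>
  do not contribute at time \<open>k\<close>, and \<open>lord_level_eq\<close> below is the unguarded equation.\<close>

function lord_level :: "real \<Rightarrow> real \<Rightarrow> (nat \<Rightarrow> real) \<Rightarrow> (nat \<Rightarrow> real) \<Rightarrow> nat \<Rightarrow> real" where
  "lord_level \<alpha> W0 g x k =
     lord_formula \<alpha> W0 g (\<lambda>i. if i < k then x i \<le> lord_level \<alpha> W0 g x i else False) k"
  by pat_completeness auto
termination by (relation "Wellfounded.measure (\<lambda>(_, _, _, _, k). k)") auto

declare lord_level.simps [simp del]

definition lord_reject :: "real \<Rightarrow> real \<Rightarrow> (nat \<Rightarrow> real) \<Rightarrow> (nat \<Rightarrow> real) \<Rightarrow> nat \<Rightarrow> bool" where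
  "lord_reject \<alpha> W0 g x k \<longleftrightarrow> x k \<le> lord_level \<alpha> W0 g x k"

definition lord_R :: "real \<Rightarrow> real \<Rightarrow> (nat \<Rightarrow> real) \<Rightarrow> (nat \<Rightarrow> real) \<Rightarrow> nat \<Rightarrow> nat" where
  "lord_R \<alpha> W0 g x k = num_rejections (lord_reject \<alpha> W0 g x) k"

lemma rejection_time_eq_enat:
  "rejection_time rej j = enat n \<longleftrightarrow>
     num_rejections rej n = j \<and> (\<forall>m<n. num_rejections rej m \<noteq> j)" (is "?L \<longleftrightarrow> ?R")
proof
  assume L: ?L
  let ?A = "enat ` {k. num_rejections rej k = j}"
  have "?A \<noteq> {}"
  proof
    assume "?A = {}"
    with L show False
      unfolding rejection_time_def by (simp only: Inf_enat_def) auto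
  qed
  then have "Inf ?A \<in> ?A"
    by (meson ex_in_conv wellorder_InfI)
  with L have n: "num_rejections rej n = j"
    unfolding rejection_time_def by auto
  have "enat n \<le> enat m" if "num_rejections rej m = j" for m
  proof -
    have "rejection_time rej j \<le> enat m"
      unfolding rejection_time_def using that by (intro INF_lower) simp
    with L show ?thesis by simp
  qed
  with n show ?R by (force simp: not_le[symmetric])
next
  assume R: ?R
  have "n \<le> m" if "num_rejections rej m = j" for m
    using R that by (cases "m < n") auto
  then show ?L
    unfolding rejection_time_def using R by (intro antisym INF_lower INF_greatest) auto
qed

lemma lagged_rejection_time_cong:
  assumes "\<And>i. i < k \<Longrightarrow> rej i = rej' i"
  shows "lagged g k (rejection_time rej j) = lagged g k (rejection_time rej' j)"
proof -
  have num: "num_rejections rej m = num_rejections rej' m" if "m < k" for m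
    unfolding num_rejections_def using assms that by (intro arg_cong[of _ _ card]) auto
  have iff: "rejection_time rej j = enat n \<longleftrightarrow> rejection_time rej' j = enat n" if "n < k" for n
    using that num by (auto simp: rejection_time_eq_enat)
  show ?thesis
    using iff by (cases "rejection_time rej j"; cases "rejection_time rej' j")
      (auto simp: lagged_def)
qed

lemma lord_level_eq:
  "lord_level \<alpha> W0 g x k = lord_formula \<alpha> W0 g (lord_reject \<alpha> W0 g x) k"
proof -
  have "lagged g k (rejection_time (\<lambda>i. if i < k then x i \<le> lord_level \<alpha> W0 g x i else False) j)
      = lagged g k (rejection_time (lord_reject \<alpha> W0 g x) j)" for j
    by (rule lagged_rejection_time_cong) (simp add: lord_reject_def)
  then show ?thesis
    by (subst lord_level.simps) (simp only: lord_formula_def)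
qed

definition spending :: "real \<Rightarrow> real \<Rightarrow> nat \<Rightarrow> real" where
  "spending z \<gamma> k = z / (real k * ln (real (max k 2)) powr \<gamma>)"

subsection \<open>The envelopes\<close>

definition kappa :: real where
  "kappa = pi\<^sup>2 / 6"

definition delta_at :: "real \<Rightarrow> nat \<Rightarrow> real" where
  "delta_at \<delta> a = \<delta> / (kappa * (real a)\<^sup>2)"

definition eps :: "real \<Rightarrow> real \<Rightarrow> real" where
  "eps \<delta> u = ln ((1 + kappa) / \<delta>) + 2 * ln (1 + log 2 (max u 1))"

definition Delta :: "real \<Rightarrow> real \<Rightarrow> real" where
  "Delta \<delta> u = 2 * sqrt (eps \<delta> u) * sqrt (max u 1) + 1 / 2 * eps \<delta> u"

definition fdp_freed :: "real \<Rightarrow> real \<Rightarrow> nat \<Rightarrow> real" where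
  "fdp_freed \<alpha> \<delta> R =
     min 1 (\<alpha> + Delta \<delta> (\<alpha> * real (max 1 R)) / real (max 1 R))"

definition kru_term :: "real \<Rightarrow> real \<Rightarrow> nat \<Rightarrow> nat \<Rightarrow> real" where
  "kru_term \<alpha> \<delta> R a =
     ln (1 / delta_at \<delta> a) / (real a * ln (1 + ln (1 / delta_at \<delta> a) / real a))
     * (\<alpha> + real a / real (max 1 R))"

text \<open>\<open>kru_min_attained\<close> below shows that this infimum is a minimum.\<close>

definition fdp_kru :: "real \<Rightarrow> real \<Rightarrow> nat \<Rightarrow> real" where
  "fdp_kru \<alpha> \<delta> R = min 1 (INF a\<in>{1..}. kru_term \<alpha> \<delta> R a)"

lemma kappa_gt_1: "kappa > 1"
proof -
  have "3 * 3 < pi * pi" using pi_gt3 by (intro mult_strict_mono) auto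
  then show ?thesis by (simp add: kappa_def power2_eq_square)
qed

lemma kru_term_ge:
  assumes "0 < \<alpha>" "0 < \<delta>" "\<delta> < 1" "a \<ge> 1"
  shows "kru_term \<alpha> \<delta> R a \<ge> real a / real (max 1 R)"
proof -
  define L where "L = ln (1 / delta_at \<delta> a)"
  have a: "real a \<ge> 1" using assms by simp
  have "1 * 1 \<le> kappa * (real a)\<^sup>2"
    using kappa_gt_1 a by (intro mult_mono) auto
  then have "delta_at \<delta> a < 1" "delta_at \<delta> a > 0"
    using assms by (auto simp: delta_at_def divide_simps)
  then have L: "L > 0" by (simp add: L_def)
  have pos: "ln (1 + L / real a) > 0" using L a by (intro ln_gt_zero) (simp add: divide_pos_pos)
  have "ln (1 + L / real a) \<le> L / real a"
    using L a by (intro ln_add_one_self_le_self) simp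
  then have "real a * ln (1 + L / real a) \<le> L"
    using a by (simp add: field_simps)
  then have "1 \<le> L / (real a * ln (1 + L / real a))"
    using pos a by simp
  then have "1 * (real a / real (max 1 R)) \<le>
      L / (real a * ln (1 + L / real a)) * (\<alpha> + real a / real (max 1 R))"
    using assms by (intro mult_mono) auto
  then show ?thesis by (simp add: kru_term_def L_def)
qed

lemma kru_min_attained:
  assumes "0 < \<alpha>" "0 < \<delta>" "\<delta> < 1"
  shows "\<exists>a\<ge>1. kru_term \<alpha> \<delta> R a = (INF a\<in>{1..}. kru_term \<alpha> \<delta> R a)
           \<and> (\<forall>b\<ge>1. kru_term \<alpha> \<delta> R a \<le> kru_term \<alpha> \<delta> R b)"
proof -
  let ?f = "kru_term \<alpha> \<delta> R"
  define N where "N = max 1 (nat \<lceil>?f 1 * real (max 1 R)\<rceil>)"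
  have big: "?f 1 \<le> ?f b" if "b > N" for b
  proof -
    have "?f 1 * real (max 1 R) \<le> real b"
      using that unfolding N_def by linarith
    then have "?f 1 \<le> real b / real (max 1 R)"
      by (simp add: field_simps)
    also have "\<dots> \<le> ?f b"
      using assms that by (intro kru_term_ge) (auto simp: N_def)
    finally show ?thesis .
  qed
  have fin: "finite {1..N}" "{1..N} \<noteq> {}" by (auto simp: N_def)
  obtain a where a: "a \<in> {1..N}" and min: "\<And>b. b \<in> {1..N} \<Longrightarrow> ?f a \<le> ?f b"
    using ex_is_arg_min_if_finite[OF fin, of ?f] by (auto simp: is_arg_min_linorder)
  have le: "?f a \<le> ?f b" if "b \<ge> 1" for b
  proof (cases "b \<le> N")
    case True
    then show ?thesis using min that by simp
  next
    case False
    then have "?f 1 \<le> ?f b" by (intro big) simp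
    moreover have "?f a \<le> ?f 1" by (rule min) (simp add: N_def)
    ultimately show ?thesis by simp
  qed
  have "(INF b\<in>{1..}. ?f b) = ?f a"
    using a le by (intro cInf_eq_minimum) auto
  then show ?thesis using a le by (intro exI[of _ a]) auto
qed

end

theory Submission
  imports Defs "HOL-Real_Asymp.Real_Asymp"
begin

text \<open>
  Both envelopes are deterministic functions of \<open>R(k)\<close> that fall below \<open>\<alpha> + \<epsilon>\<close> once \<open>R(k)\<close> is
  large; for the second one fixes an integer \<open>a\<close> for which the prefactor is close to \<open>1\<close> and lets
  \<open>R(k)\<close> grow. So it suffices that \<open>R(k) \<rightarrow> \<infinity>\<close> in probability. Since \<open>\<alpha>\<^sub>k \<ge> W\<^sub>0 \<gamma>\<^sub>k\<close>, every time \<open>k\<close>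
  with \<open>p\<^sub>k \<le> W\<^sub>0 \<gamma>\<^sub>k\<close> is a rejection. These events are independent, of probability at least
  \<open>\<pi>\<^sub>1 F\<^sub>1(W\<^sub>0 \<gamma>\<^sub>k)\<close>, and in the Gaussian model \<open>F\<^sub>1(x) / x\<close> exceeds every power of \<open>ln (1/x)\<close> as
  \<open>x \<rightarrow> 0\<close>, so these probabilities are eventually at least a multiple of \<open>1/k\<close> and have infinite sum.

  Measurability of the envelope events is not an issue: each is contained in the measurable event
  that fewer than \<open>m\<close> of these hits occurred, and \<^const>\<open>measure\<close> is \<open>0\<close> on non-measurable sets.
\<close>

section \<open>Divergent sums and hits of independent events\<close>

text \<open>Partial sums of nonnegative terms increase, so if they lie below some \<open>Z\<close>
  at arbitrarily late indices, they are all bounded by \<open>Z\<close>, and the series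
  converges.\<close>

lemma filterlim_sum_at_top_of_not_summable:
  fixes f :: "nat \<Rightarrow> real"
  assumes nonneg: "\<And>i. f i \<ge> 0" and ns: "\<not> summable f"
  shows "filterlim (\<lambda>n. \<Sum>i=1..n. f i) at_top sequentially"
proof -
  have ns': "\<not> summable (\<lambda>i. f (Suc i))"
    using ns by (simp add: summable_Suc_iff)
  have "\<forall>\<^sub>F n in sequentially. Z \<le> (\<Sum>i=1..n. f i)" for Z
  proof (rule ccontr)
    assume "\<not> ?thesis"
    then have freq: "\<exists>n\<ge>m. (\<Sum>i=1..n. f i) < Z" for m
      by (auto simp: eventually_sequentially not_le)
    have "(\<Sum>i<m. f (Suc i)) \<le> Z" for m
    proof -
      obtain n where "n \<ge> m" and n: "(\<Sum>i=1..n. f i) < Z" using freq by blast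
      have "(\<Sum>i<m. f (Suc i)) = (\<Sum>i=1..m. f i)"
        by (rule sum.reindex_bij_witness[of _ "\<lambda>i. i - 1" Suc]) auto
      also have "\<dots> \<le> (\<Sum>i=1..n. f i)"
        using \<open>n \<ge> m\<close> nonneg by (intro sum_mono2) auto
      finally show ?thesis using n by simp
    qed
    then have "summable (\<lambda>i. f (Suc i))"
      using nonneg by (intro summableI_nonneg_bounded)
    with ns' show False by contradiction
  qed
  then show ?thesis by (simp add: filterlim_at_top)
qed

text \<open>A quantitative second Borel--Cantelli lemma: Markov's inequality is applied to
  \<open>(1/2)\<^sup>C\<close>, where \<open>C\<close> counts the hits, and independence gives
  \<open>E (1/2)\<^sup>C = \<Prod>\<^sub>i (1 - P\<^sub>i / 2) \<le> exp (- \<Sum>\<^sub>i P\<^sub>i / 2)\<close>.\<close>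

lemma (in prob_space) prob_few_hits_tendsto_0:
  fixes X :: "nat \<Rightarrow> 'a \<Rightarrow> 'b" and S :: "nat \<Rightarrow> 'b set"
  assumes indep: "indep_vars N X {1..}" and S: "\<And>i. i \<ge> 1 \<Longrightarrow> S i \<in> sets (N i)"
    and div: "filterlim (\<lambda>n. \<Sum>i=1..n. prob {\<omega>\<in>space M. X i \<omega> \<in> S i}) at_top sequentially"
  shows "(\<lambda>n. prob {\<omega>\<in>space M. card {i\<in>{1..n}. X i \<omega> \<in> S i} < m}) \<longlonglongrightarrow> 0"
    and "{\<omega>\<in>space M. card {i\<in>{1..n}. X i \<omega> \<in> S i} < m} \<in> events"
proof -
  define P where "P i = prob {\<omega>\<in>space M. X i \<omega> \<in> S i}" for i
  define Y where "Y i x = (if x \<in> S i then 1/2 else 1::real)" for i x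
  define C where "C n \<omega> = card {i\<in>{1..n}. X i \<omega> \<in> S i}" for n \<omega>
  have X_meas: "X i \<in> measurable M (N i)" if "i \<ge> 1" for i
    using indep that by (auto simp: indep_vars_def)
  have ev: "{\<omega>\<in>space M. X i \<omega> \<in> S i} \<in> events" if "i \<ge> 1" for i
    using measurable_sets[OF X_meas[OF that] S[OF that]] by (simp add: vimage_def Int_def conj_commute)
  have Y_meas: "Y i \<in> borel_measurable (N i)" if "i \<ge> 1" for i
    unfolding Y_def using S[OF that] by measurable
  have indY: "indep_vars (\<lambda>_. borel) (\<lambda>i \<omega>. Y i (X i \<omega>)) {1..n}" for n
    by (rule indep_vars_subset[OF indep_vars_compose2[OF indep Y_meas]]) auto
  have YX: "Y i (X i \<omega>) = 1 - indicator {\<omega>\<in>space M. X i \<omega> \<in> S i} \<omega> / 2" if "\<omega> \<in> space M" for i \<omega>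
    using that by (auto simp: Y_def indicator_def)
  have intY: "integrable M (\<lambda>\<omega>. Y i (X i \<omega>))" if "i \<ge> 1" for i
  proof -
    have "integrable M (\<lambda>\<omega>. 1 - indicator {\<omega>\<in>space M. X i \<omega> \<in> S i} \<omega> / 2 :: real)"
      using ev[OF that] by (intro Bochner_Integration.integrable_diff integrable_divide
          integrable_real_indicator) (auto simp: emeasure_eq_measure)
    then show ?thesis
      by (rule Bochner_Integration.integrable_cong[THEN iffD1, rotated -1]) (auto simp: YX)
  qed
  have expY: "expectation (\<lambda>\<omega>. Y i (X i \<omega>)) = 1 - P i / 2" if "i \<ge> 1" for i
  proof -
    have "expectation (\<lambda>\<omega>. Y i (X i \<omega>)) =
        expectation (\<lambda>\<omega>. 1 - indicator {\<omega>\<in>space M. X i \<omega> \<in> S i} \<omega> / 2)"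
      by (intro Bochner_Integration.integral_cong) (auto simp: YX)
    also have "\<dots> = 1 - P i / 2"
      using ev[OF that] by (subst Bochner_Integration.integral_diff)
        (auto simp: emeasure_eq_measure P_def prob_space Int_absorb1 intro!: integrable_real_indicator)
    finally show ?thesis .
  qed
  have prodC: "(\<Prod>i=1..n. Y i (X i \<omega>)) = (1/2) ^ C n \<omega>" for n \<omega>
    unfolding Y_def C_def by (subst prod.If_cases) (auto simp: Int_def)
  have int_prod: "integrable M (\<lambda>\<omega>. (1/2::real) ^ C n \<omega>)" for n
    unfolding prodC[symmetric] by (rule indep_vars_integrable[OF _ indY]) (auto intro: intY)
  have "expectation (\<lambda>\<omega>. (1/2) ^ C n \<omega>) = (\<Prod>i=1..n. 1 - P i / 2)" for n
    unfolding prodC[symmetric]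
    by (subst indep_vars_lebesgue_integral[OF _ indY]) (auto intro: intY simp: expY)
  also have "(\<Prod>i=1..n. 1 - P i / 2) \<le> (\<Prod>i=1..n. exp (- (P i / 2)))" for n
  proof (rule prod_mono)
    fix i
    have "P i \<le> 1" by (simp add: P_def)
    then show "0 \<le> 1 - P i / 2 \<and> 1 - P i / 2 \<le> exp (- (P i / 2))"
      using exp_ge_add_one_self[of "- (P i / 2)"] by auto
  qed
  also have "(\<Prod>i=1..n. exp (- (P i / 2))) = exp (- ((\<Sum>i=1..n. P i) / 2))" for n
    by (simp add: exp_sum[symmetric] sum_negf sum_divide_distrib)
  finally have E_le: "expectation (\<lambda>\<omega>. (1/2) ^ C n \<omega>) \<le> exp (- ((\<Sum>i=1..n. P i) / 2))" for n .

  \<comment> \<open>In this form measurability of the event follows from that of the integrable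
    function \<open>(1/2) ^ C n \<omega>\<close>, with no argument about cardinalities.\<close>
  have few: "{\<omega>\<in>space M. C n \<omega> < m} = {\<omega>\<in>space M. (1/2) ^ C n \<omega> > (1/2::real) ^ m}" for n
    by auto
  show "{\<omega>\<in>space M. card {i\<in>{1..n}. X i \<omega> \<in> S i} < m} \<in> events"
    using borel_measurable_integrable[OF int_prod] unfolding C_def[symmetric] few by measurable
  have le: "prob {\<omega>\<in>space M. C n \<omega> < m} \<le> 2 ^ m * exp (- ((\<Sum>i=1..n. P i) / 2))" for n
  proof -
    have [measurable]: "(\<lambda>\<omega>. (1/2::real) ^ C n \<omega>) \<in> borel_measurable M"
      by (rule borel_measurable_integrable[OF int_prod])
    \<comment> \<open>Markov's inequality bounds the non-strict event, which contains the strict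
      one.\<close>
    have "{\<omega>\<in>space M. (1/2) ^ C n \<omega> \<ge> (1/2::real) ^ m} \<in> events" by measurable
    then have "prob {\<omega>\<in>space M. C n \<omega> < m} \<le> prob {\<omega>\<in>space M. (1/2) ^ C n \<omega> \<ge> (1/2::real) ^ m}"
      by (intro finite_measure_mono) (auto simp: power_decreasing_iff)
    also have "\<dots> \<le> expectation (\<lambda>\<omega>. (1/2) ^ C n \<omega>) / (1/2) ^ m"
      by (rule integral_Markov_inequality_measure[where A = "{}"]) (auto intro: int_prod)
    also have "\<dots> = 2 ^ m * expectation (\<lambda>\<omega>. (1/2) ^ C n \<omega>)"
      by (simp add: power_one_over)
    also have "\<dots> \<le> 2 ^ m * exp (- ((\<Sum>i=1..n. P i) / 2))"
      by (intro mult_left_mono E_le) auto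
    finally show ?thesis .
  qed
  have "(\<lambda>n. exp (- ((\<Sum>i=1..n. P i) / 2))) \<longlonglongrightarrow> 0"
    using div unfolding P_def
    by (auto intro!: filterlim_compose[OF exp_at_bot]
        filterlim_tendsto_pos_mult_at_top[OF tendsto_const, of "1/2", simplified]
        simp: filterlim_uminus_at_top[symmetric])
  then have lim: "(\<lambda>n. 2 ^ m * exp (- ((\<Sum>i=1..n. P i) / 2))) \<longlonglongrightarrow> 0"
    by (rule tendsto_mult_right_zero)
  show "(\<lambda>n. prob {\<omega>\<in>space M. card {i\<in>{1..n}. X i \<omega> \<in> S i} < m}) \<longlonglongrightarrow> 0"
    unfolding C_def[symmetric]
    by (rule tendsto_sandwich[OF _ _ tendsto_const lim]) (use le in simp_all)
qed

section \<open>Gaussian tails, quantiles and the alternative distribution\<close>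

lemma Phi_bar_eq_LINT: "Phi_bar x = (LINT s:{x<..}|lborel. std_normal_density s)"
proof -
  have "Phi_bar x = (LINT s|std_normal_distribution. indicator {x<..} s)"
    by (simp add: Phi_bar_def)
  also have "\<dots> = (LINT s|lborel. std_normal_density s * indicator {x<..} s)"
    by (subst integral_density) auto
  finally show ?thesis
    by (simp add: set_lebesgue_integral_def mult.commute)
qed

lemma set_integrable_std_normal_density:
  "A \<in> sets borel \<Longrightarrow> set_integrable lborel A std_normal_density"
  unfolding set_integrable_def by (intro integrable_mult_indicator) auto

lemma Phi_bar_antimono: "x \<le> y \<Longrightarrow> Phi_bar y \<le> Phi_bar x"
proof -
  interpret real_distribution std_normal_distribution by (rule real_dist_normal_dist)
  show "x \<le> y \<Longrightarrow> Phi_bar y \<le> Phi_bar x"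
    unfolding Phi_bar_def by (intro finite_measure_mono) auto
qed

text \<open>As \<open>inv\<close> chooses some preimage, it is enough that \<open>x\<close> lies in
  the range of \<open>Phi_bar\<close>. The normal law has no atoms, so its cdf is continuous, and
  its limits 0 and 1 bring in the intermediate value theorem.\<close>

lemma inv_Phi_bar:
  assumes "0 < x" "x < 1"
  shows "Phi_bar (inv Phi_bar x) = x"
proof -
  interpret real_distribution std_normal_distribution by (rule real_dist_normal_dist)
  let ?F = "cdf std_normal_distribution"
  have Phi: "Phi_bar t = 1 - ?F t" for t
  proof -
    have "{t<..} = space std_normal_distribution - {..t}" by auto
    then show ?thesis unfolding Phi_bar_def cdf_def2 by (subst prob_compl[symmetric]) auto
  qed
  have "isCont ?F t" for t
  proof -
    have "emeasure std_normal_distribution {t} = 0"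
      by (subst emeasure_density) (auto intro!: nn_integral_0_iff_AE[THEN iffD2] AE_I[where N = "{t}"])
    then show ?thesis by (simp add: isCont_cdf measure_def)
  qed
  moreover obtain a where "?F a < 1 - x"
    using order_tendstoD(2)[OF cdf_lim_at_bot, of "1 - x"] assms
    by (auto simp: eventually_at_bot_linorder)
  moreover obtain b where "?F b > 1 - x"
    using order_tendstoD(1)[OF cdf_lim_at_top_prob, of "1 - x"] assms
    by (auto simp: eventually_at_top_linorder)
  moreover have "a \<le> b" using calculation cdf_nondecreasing[of b a] by linarith
  ultimately obtain t where "?F t = 1 - x"
    using IVT[of ?F a "1 - x" b] by auto
  then have "x \<in> range Phi_bar" using Phi[of t] by (intro range_eqI[of _ _ t]) simp
  then show ?thesis by (rule f_inv_into_f)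
qed

text \<open>The tail contains an interval of length 1 on which the density is smallest at the right
  end. This crude bound is enough for arguments as small as a multiple of
  \<open>ln (ln k)\<close>.\<close>

lemma Phi_bar_ge_density:
  assumes "t \<ge> 0"
  shows "Phi_bar t \<ge> std_normal_density (t + 1)"
proof -
  have "std_normal_density (t + 1) = (LINT s:{t<..t+1}|lborel. std_normal_density (t + 1))"
    by (simp add: set_lebesgue_integral_def)
  also have "\<dots> \<le> (LINT s:{t<..t+1}|lborel. std_normal_density s)"
  proof (rule set_integral_mono)
    show "set_integrable lborel {t<..t+1} (\<lambda>s. std_normal_density (t + 1))"
      by (simp add: set_integrable_def)
    fix s assume "s \<in> {t<..t+1}"
    with assms have "s\<^sup>2 \<le> (t + 1)\<^sup>2" by (intro power_mono) auto
    then show "std_normal_density (t + 1) \<le> std_normal_density s"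
      by (auto simp: std_normal_density_def intro!: divide_right_mono)
  qed (simp add: set_integrable_std_normal_density)
  also have "\<dots> \<le> Phi_bar t"
    unfolding Phi_bar_eq_LINT set_lebesgue_integral_def
    by (intro integral_mono set_integrable_std_normal_density[unfolded set_integrable_def])
      (auto simp: indicator_def)
  finally show ?thesis .
qed

text \<open>The likelihood ratio of \<open>N(\<mu>,1)\<close> against \<open>N(0,1)\<close> at \<open>s\<close> is
  \<open>exp (\<mu> s - \<mu>\<^sup>2/2)\<close>, which is at least its value at \<open>t\<close> on the tail \<open>s > t\<close>.\<close>

lemma Phi_bar_shift_ge:
  assumes "\<mu> \<ge> 0"
  shows "Phi_bar (t - \<mu>) \<ge> exp (\<mu> * t - \<mu>\<^sup>2 / 2) * Phi_bar t"
proof -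
  have ratio: "std_normal_density (s - \<mu>) = exp (\<mu> * s - \<mu>\<^sup>2 / 2) * std_normal_density s" for s
  proof -
    have "- (s - \<mu>)\<^sup>2 / 2 = (\<mu> * s - \<mu>\<^sup>2 / 2) + (- s\<^sup>2 / 2)"
      by (simp add: power2_eq_square algebra_simps add_divide_distrib diff_divide_distrib)
    then show ?thesis by (simp add: std_normal_density_def exp_add[symmetric])
  qed
  have int: "set_integrable lborel {t<..} (\<lambda>s. std_normal_density (s - \<mu>))"
  proof -
    have "integrable lborel (\<lambda>s. std_normal_density (- \<mu> + 1 * s))"
      by (rule lborel_integrable_real_affine) auto
    then have "integrable lborel (\<lambda>s. std_normal_density (s - \<mu>))" by simp
    then show ?thesis unfolding set_integrable_def by (intro integrable_mult_indicator) auto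
  qed
  have "exp (\<mu> * t - \<mu>\<^sup>2 / 2) * Phi_bar t
      = (LINT s:{t<..}|lborel. exp (\<mu> * t - \<mu>\<^sup>2 / 2) * std_normal_density s)"
    by (simp add: Phi_bar_eq_LINT)
  also have "\<dots> \<le> (LINT s:{t<..}|lborel. std_normal_density (s - \<mu>))"
  proof (rule set_integral_mono)
    show "set_integrable lborel {t<..} (\<lambda>s. exp (\<mu> * t - \<mu>\<^sup>2 / 2) * std_normal_density s)"
      by (intro set_integrable_mult_right) (simp add: set_integrable_std_normal_density)
    fix s assume "s \<in> {t<..}"
    with assms have "\<mu> * t \<le> \<mu> * s" by (intro mult_left_mono) auto
    then show "exp (\<mu> * t - \<mu>\<^sup>2 / 2) * std_normal_density s \<le> std_normal_density (s - \<mu>)"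
      unfolding ratio by (intro mult_right_mono) auto
  qed (rule int)
  also have "\<dots> = Phi_bar (t - \<mu>)"
  proof -
    \<comment> \<open>The indicator is rewritten in terms of \<open>s - \<mu>\<close>, so that the
      whole integrand depends on the translated variable only and translation invariance
      applies.\<close>
    have ind: "indicator {t<..} s = (indicator {t - \<mu><..} (s - \<mu>) :: real)" for s
      by (auto simp: indicator_def)
    show ?thesis
      unfolding Phi_bar_eq_LINT set_lebesgue_integral_def ind
      using lborel_integral_real_affine[of 1 "\<lambda>s. indicator {t - \<mu><..} s *\<^sub>R std_normal_density s" "- \<mu>"]
      by simp
  qed
  finally show ?thesis .
qed

text \<open>For the upper Gaussian quantile \<open>t\<close> of \<open>w \<gamma>\<^sub>k\<close>, the tail bound gives
  \<open>t \<ge> (\<gamma>/\<mu>) ln (ln k)\<close>, and the likelihood ratio then compensates the factor \<open>ln\<^sup>\<gamma> k\<close>.\<close>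

lemma gaussian_alt_cdf_spending_ge:
  assumes "0 < \<mu>" "0 < \<gamma>" "0 < w" "0 < z"
  shows "\<forall>\<^sub>F k in sequentially.
    gaussian_alt_cdf \<mu> (w * spending z \<gamma> k) \<ge> w * z * exp (- \<mu>\<^sup>2 / 2) / real k"
proof -
  \<comment> \<open>With this \<open>c\<close>, \<open>exp (\<mu> * (c * ln (ln k)))\<close> is
    exactly \<open>ln k powr \<gamma>\<close>, the logarithmic factor of the spending
    sequence.\<close>
  define c where "c = \<gamma> / \<mu>"
  define b where "b = w * z"
  have c: "c > 0" and b: "b > 0" using assms by (auto simp: c_def b_def)
  have "\<forall>\<^sub>F k in sequentially. b / (real k * ln (real k) powr \<gamma>) < 1"
    using b \<open>0 < \<gamma>\<close> by real_asymp
  \<comment> \<open>The right side is the normal density at \<open>c * ln (ln k) + 1\<close>. It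
    decays only like the exponential of a multiple of \<open>- (ln (ln k))^2\<close>, hence more
    slowly than \<open>1 / k\<close>.\<close>
  moreover have "\<forall>\<^sub>F k in sequentially. b / (real k * ln (real k) powr \<gamma>)
      < 1 / sqrt (2 * pi) * exp (- (c * ln (ln (real k)) + 1)\<^sup>2 / 2)"
    using b c \<open>0 < \<gamma>\<close> by real_asymp
  \<comment> \<open>From 3 on, \<open>max k 2\<close> is \<open>k\<close>, and \<open>ln k\<close>
    is at least 1, which makes \<open>ln (ln k)\<close> nonnegative.\<close>
  moreover have "\<forall>\<^sub>F k in sequentially. k \<ge> (3::nat)"
    by (rule eventually_ge_at_top)
  ultimately show ?thesis
  proof eventually_elim
    case (elim k)
    define x where "x = w * spending z \<gamma> k"
    define s where "s = c * ln (ln (real k))"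
    define t where "t = inv Phi_bar x"
    have x: "x = b / (real k * ln (real k) powr \<gamma>)"
      using elim by (simp add: x_def b_def spending_def)
    have "exp 1 \<le> real k" using e_less_272 elim by linarith
    then have lnk: "ln (real k) \<ge> 1" using elim by (subst ln_ge_iff) auto
    have x01: "0 < x" "x < 1" using elim b lnk by (auto simp: x)
    have s0: "s \<ge> 0" using c lnk by (simp add: s_def)
    have Phi_t: "Phi_bar t = x" unfolding t_def by (rule inv_Phi_bar[OF x01])
    have "x < std_normal_density (s + 1)"
      using elim unfolding x s_def std_normal_density_def by simp
    also have "\<dots> \<le> Phi_bar s" by (rule Phi_bar_ge_density[OF s0])
    finally have "s \<le> t" using Phi_bar_antimono[of t s] Phi_t by linarith
    have "exp (\<mu> * s) = ln (real k) powr \<gamma>"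
      using assms lnk by (simp add: s_def c_def powr_def)
    then have "b * exp (- \<mu>\<^sup>2 / 2) / real k = exp (\<mu> * s - \<mu>\<^sup>2 / 2) * x"
      using elim lnk by (simp add: x diff_conv_add_uminus exp_add del: add_uminus_conv_diff)
    also have "\<dots> \<le> exp (\<mu> * t - \<mu>\<^sup>2 / 2) * x"
      using assms \<open>s \<le> t\<close> x01 by (intro mult_right_mono) auto
    also have "\<dots> \<le> Phi_bar (t - \<mu>)"
      using Phi_bar_shift_ge[of \<mu> t] assms Phi_t by simp
    also have "\<dots> = gaussian_alt_cdf \<mu> x"
      using x01 by (simp add: gaussian_alt_cdf_def t_def)
    finally show ?case by (simp add: x_def b_def)
  qed
qed

section \<open>Lower bounds for rejections and hit probabilities\<close>

text \<open>The wealth earned back by rejections only adds nonnegative terms. The remaining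
  threshold is deterministic, so the hits it defines are independent over time.\<close>

lemma lord_level_ge:
  assumes "\<And>k. g k \<ge> 0" "W0 \<le> \<alpha>" "0 \<le> \<alpha>"
  shows "lord_level \<alpha> W0 g x k \<ge> W0 * g k"
proof -
  have nn: "lagged g k t \<ge> 0" for t
    using assms by (auto simp: lagged_def split: enat.splits)
  \<comment> \<open>A divergent \<open>infsum\<close> is 0 by default, so nonnegativity of the terms
    settles both cases.\<close>
  have "(\<Sum>\<^sub>\<infinity>j\<in>{2..}. lagged g k (rejection_time (lord_reject \<alpha> W0 g x) j)) \<ge> 0"
    by (rule infsum_nonneg) (rule nn)
  then show ?thesis
    using assms nn by (simp add: lord_level_eq lord_formula_def)
qed

lemma card_le_lord_R:
  assumes "\<And>k. g k \<ge> 0" "W0 \<le> \<alpha>" "0 \<le> \<alpha>"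
  shows "card {i\<in>{1..k}. x i \<le> W0 * g i} \<le> lord_R \<alpha> W0 g x k"
  unfolding lord_R_def num_rejections_def lord_reject_def
  using lord_level_ge[where g = g and x = x, OF assms] by (intro card_mono) (auto intro: order_trans)

text \<open>Only hits with \<open>H k \<omega> = 1\<close> are kept. For a spending sequence of
  finite total, the null hits have summable probabilities, so divergence must come from the
  alternatives.\<close>

lemma (in online_mixture) prob_p_le_ge:
  assumes "k \<ge> 1" "x \<in> {0..1}" "\<pi>1 \<noteq> 0"
  shows "\<P>(\<omega> in M. p k \<omega> \<le> x) \<ge> \<pi>1 * F1 x"
proof -
  have pair: "(\<lambda>\<omega>. (p k \<omega>, H k \<omega>)) \<in> M \<rightarrow>\<^sub>M borel \<Otimes>\<^sub>M count_space UNIV"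
    using indep assms by (auto simp: indep_vars_def)
  have [measurable]: "p k \<in> borel_measurable M"
    using measurable_compose[OF pair measurable_fst] by simp
  have "\<pi>1 * F1 x = \<P>(\<omega> in M. p k \<omega> \<le> x \<and> H k \<omega> = 1)"
    using alt_law[of k x] prob_H[of k] assms by (simp add: cond_prob_def divide_simps mult.commute)
  also have "\<dots> \<le> \<P>(\<omega> in M. p k \<omega> \<le> x)"
    by (rule finite_measure_mono) auto
  finally show ?thesis .
qed

section \<open>The envelopes for a growing number of rejections\<close>

text \<open>Since \<open>eps\<close> grows like an iterated logarithm, \<open>Delta\<close> at
  \<alpha> R is of order sqrt (R ln ln R), which is negligible against R. Once \<alpha> R and R are
  at least 1, the truncating maxima disappear.\<close>

lemma fdp_freed_tendsto:
  assumes "0 < \<alpha>" "\<alpha> < 1" "0 < \<delta>" "\<delta> < 1"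
  shows "(\<lambda>R. fdp_freed \<alpha> \<delta> R) \<longlonglongrightarrow> \<alpha>"
proof -
  define l where "l = ln ((1 + kappa) / \<delta>)"
  have "(1 + kappa) / \<delta> > 1" using kappa_gt_1 assms by (simp add: field_simps)
  then have l: "l > 0" by (simp add: l_def)
  have "\<forall>\<^sub>F R in sequentially. \<alpha> * real R \<ge> 1" using assms by real_asymp
  then have "\<forall>\<^sub>F R in sequentially.
      \<alpha> + (2 * sqrt (l + 2 * ln (1 + log 2 (\<alpha> * real R))) * sqrt (\<alpha> * real R)
        + 1 / 2 * (l + 2 * ln (1 + log 2 (\<alpha> * real R)))) / real R
      = \<alpha> + Delta \<delta> (\<alpha> * real (max 1 R)) / real (max 1 R)"
    using eventually_ge_at_top[of 1]
    by eventually_elim (simp add: Delta_def eps_def l_def max_def)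
  moreover have "(\<lambda>R. \<alpha> + (2 * sqrt (l + 2 * ln (1 + log 2 (\<alpha> * real R))) * sqrt (\<alpha> * real R)
        + 1 / 2 * (l + 2 * ln (1 + log 2 (\<alpha> * real R)))) / real R) \<longlonglongrightarrow> \<alpha>"
    using assms l by real_asymp
  ultimately have "(\<lambda>R. \<alpha> + Delta \<delta> (\<alpha> * real (max 1 R)) / real (max 1 R)) \<longlonglongrightarrow> \<alpha>"
    using Lim_transform_eventually by fast
  then have "(\<lambda>R. fdp_freed \<alpha> \<delta> R) \<longlonglongrightarrow> min 1 \<alpha>"
    unfolding fdp_freed_def by (intro tendsto_min tendsto_const)
  with assms show ?thesis by simp
qed

lemma fdp_kru_eventually_less:
  assumes "0 < \<alpha>" "0 < \<delta>" "\<delta> < 1" "0 < \<epsilon>"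
  shows "\<forall>\<^sub>F R in sequentially. fdp_kru \<alpha> \<delta> R < \<alpha> + \<epsilon>"
proof -
  define q where "q = kappa / \<delta>"
  have q: "q > 0" using kappa_gt_1 assms by (simp add: q_def)
  define f where "f a = ln (1 / delta_at \<delta> a) / (real a * ln (1 + ln (1 / delta_at \<delta> a) / real a))" for a
  have f: "f a = ln (q * (real a)\<^sup>2) / (real a * ln (1 + ln (q * (real a)\<^sup>2) / real a))" for a
    by (simp add: f_def delta_at_def q_def)
  \<comment> \<open>With y = ln (q a^2) / a the prefactor is y / ln (1 + y), and y tends to 0
    through positive values.\<close>
  have "f \<longlonglongrightarrow> 1" unfolding f using q by real_asymp
  then have "(\<lambda>a. f a * \<alpha>) \<longlonglongrightarrow> 1 * \<alpha>" by (intro tendsto_mult tendsto_const)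
  then have "\<forall>\<^sub>F a in sequentially. f a * \<alpha> < \<alpha> + \<epsilon>"
    using assms by (intro order_tendstoD(2)) auto
  then have "\<forall>\<^sub>F a in sequentially. f a * \<alpha> < \<alpha> + \<epsilon> \<and> a \<ge> 1"
    using eventually_ge_at_top by (rule eventually_conj)
  then obtain a where a: "f a * \<alpha> < \<alpha> + \<epsilon>" "a \<ge> 1"
    by (auto simp: eventually_sequentially)
  have "(\<lambda>R. real a / real (max 1 R)) \<longlonglongrightarrow> 0"
    by (rule Lim_transform_eventually[OF lim_const_over_n[of "real a"]])
      (use eventually_ge_at_top[of 1] in \<open>eventually_elim, simp add: max_def\<close>)
  then have "(\<lambda>R. f a * (\<alpha> + real a / real (max 1 R))) \<longlonglongrightarrow> f a * (\<alpha> + 0)"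
    by (intro tendsto_intros)
  then have "\<forall>\<^sub>F R in sequentially. f a * (\<alpha> + real a / real (max 1 R)) < \<alpha> + \<epsilon>"
    using a by (intro order_tendstoD(2)) auto
  then show ?thesis
  proof eventually_elim
    case (elim R)
    \<comment> \<open>Over the reals an infimum lies below each term only for a family bounded
      below.\<close>
    have "bdd_below (kru_term \<alpha> \<delta> R ` {1..})"
      by (intro bdd_belowI2[of _ 0] order_trans[OF _ kru_term_ge[OF assms(1-3)]]) auto
    then have "(INF a\<in>{1..}. kru_term \<alpha> \<delta> R a) \<le> kru_term \<alpha> \<delta> R a"
      using a by (intro cINF_lower) auto
    also have "\<dots> < \<alpha> + \<epsilon>" using elim by (simp add: kru_term_def f_def)
    finally show ?case by (simp add: fdp_kru_def)
  qed
qed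

section \<open>Growth of the rejection count and consistency\<close>

text \<open>\<open>Q\<close> stands for the failure of either envelope. As \<open>Q\<close> is false
  from some \<open>m\<close> on, it forces fewer than \<open>m\<close> rejections and therefore
  fewer than \<open>m\<close> hits.\<close>

lemma (in online_mixture) lord_R_prob_tendsto_0:
  assumes "F1 = gaussian_alt_cdf \<mu>" "0 < \<pi>1" "0 < \<mu>" "0 < W0" "W0 \<le> \<alpha>" "0 < \<gamma>" "0 < z"
    and Q: "\<forall>\<^sub>F R in sequentially. \<not> Q R"
  shows "(\<lambda>k. \<P>(\<omega> in M. Q (lord_R \<alpha> W0 (spending z \<gamma>) (\<lambda>i. p i \<omega>) k))) \<longlonglongrightarrow> 0"
proof -
  let ?x = "\<lambda>k. W0 * spending z \<gamma> k"
  \<comment> \<open>Independence is assumed for the pairs, so a hit is expressed as a pair lying in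
    a cylinder that leaves the second component free.\<close>
  let ?S = "\<lambda>k. {..?x k} \<times> (UNIV :: nat set)"
  let ?A = "\<lambda>k. {\<omega>\<in>space M. (p k \<omega>, H k \<omega>) \<in> ?S k}"
  have g_nonneg: "spending z \<gamma> k \<ge> 0" for k
    using assms by (simp add: spending_def)
  have A: "prob (?A k) = \<P>(\<omega> in M. p k \<omega> \<le> ?x k)" for k by simp
  define b where "b = \<pi>1 * (W0 * z * exp (- \<mu>\<^sup>2 / 2))"
  have b: "b > 0" using assms by (simp add: b_def)
  have "\<forall>\<^sub>F k in sequentially. ?x k \<le> 1"
  proof -
    have "\<forall>\<^sub>F k in sequentially. W0 * (z / (real k * ln (real k) powr \<gamma>)) \<le> 1"
      using assms by real_asymp
    then show ?thesis
      using eventually_ge_at_top[of 2] by eventually_elim (simp add: spending_def max_def)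
  qed
  moreover have "\<forall>\<^sub>F k in sequentially. F1 (?x k) \<ge> W0 * z * exp (- \<mu>\<^sup>2 / 2) / real k"
    unfolding assms(1) using assms by (intro gaussian_alt_cdf_spending_ge) auto
  ultimately have ev: "\<forall>\<^sub>F k in sequentially. b / real k \<le> prob (?A k)"
    using eventually_ge_at_top[of 1]
  proof eventually_elim
    case (elim k)
    have "b / real k = \<pi>1 * (W0 * z * exp (- \<mu>\<^sup>2 / 2) / real k)" by (simp add: b_def)
    also have "\<dots> \<le> \<pi>1 * F1 (?x k)" using elim assms by (intro mult_left_mono) auto
    also have "\<dots> \<le> prob (?A k)"
      unfolding A using elim assms g_nonneg by (intro prob_p_le_ge) auto
    finally show ?case .
  qed
  have "\<not> summable (\<lambda>k. prob (?A k))"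
  proof
    assume "summable (\<lambda>k. prob (?A k))"
    then have "summable (\<lambda>k. b / real k)"
      by (rule summable_comparison_test_ev[rotated]) (use ev b in auto)
    then have "summable (\<lambda>k. (1 / b) * (b / real k))" by (rule summable_mult)
    then have "summable (\<lambda>k. inverse (real k))"
      using b by (simp add: field_simps)
    then show False using not_summable_harmonic[where 'a = real] by simp
  qed
  then have "filterlim (\<lambda>n. \<Sum>k=1..n. prob (?A k)) at_top sequentially"
    by (intro filterlim_sum_at_top_of_not_summable) auto
  note few = prob_few_hits_tendsto_0[OF indep _ this]
  obtain m where m: "\<And>R. R \<ge> m \<Longrightarrow> \<not> Q R"
    using Q by (auto simp: eventually_sequentially)
  let ?B = "\<lambda>n. {\<omega>\<in>space M. card {i\<in>{1..n}. (p i \<omega>, H i \<omega>) \<in> ?S i} < m}"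
  have sub: "{\<omega>\<in>space M. Q (lord_R \<alpha> W0 (spending z \<gamma>) (\<lambda>i. p i \<omega>) n)} \<subseteq> ?B n" for n
  proof safe
    fix \<omega> assume "Q (lord_R \<alpha> W0 (spending z \<gamma>) (\<lambda>i. p i \<omega>) n)"
    then have "lord_R \<alpha> W0 (spending z \<gamma>) (\<lambda>i. p i \<omega>) n < m"
      using m not_le by blast
    moreover have "card {i\<in>{1..n}. p i \<omega> \<le> ?x i} \<le> lord_R \<alpha> W0 (spending z \<gamma>) (\<lambda>i. p i \<omega>) n"
      using assms by (intro card_le_lord_R g_nonneg) auto
    ultimately show "card {i\<in>{1..n}. (p i \<omega>, H i \<omega>) \<in> ?S i} < m" by simp
  qed
  have "prob {\<omega>\<in>space M. Q (lord_R \<alpha> W0 (spending z \<gamma>) (\<lambda>i. p i \<omega>) n)} \<le> prob (?B n)" for n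
    by (rule finite_measure_mono[OF sub]) (rule few(2), auto)
  then show ?thesis
    by (intro tendsto_sandwich[OF _ _ tendsto_const few(1)[where m = m]]) auto
qed

theorem corollary33:
  fixes M :: "'a measure"
    and p :: "nat \<Rightarrow> 'a \<Rightarrow> real" and H :: "nat \<Rightarrow> 'a \<Rightarrow> nat"
    and \<pi>1 \<mu> \<alpha> \<delta> W0 \<gamma> z :: real
  assumes "0 < \<pi>1" "\<pi>1 < 1" "0 < \<mu>"
    and "online_mixture M p H \<pi>1 (gaussian_alt_cdf \<mu>)"
    and "0 < \<alpha>" "\<alpha> < 1" "0 < \<delta>" "\<delta> < 1"
    and "0 < W0" "W0 < \<alpha>"
    and "1 < \<gamma>" "0 < z" "(\<lambda>k. spending z \<gamma> (Suc k)) sums 1"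
  shows "\<forall>\<epsilon>>0.
      (\<lambda>k. \<P>(\<omega> in M. fdp_freed \<alpha> \<delta> (lord_R \<alpha> W0 (spending z \<gamma>) (\<lambda>i. p i \<omega>) k) - \<alpha> \<ge> \<epsilon>))
        \<longlonglongrightarrow> 0
    \<and> (\<lambda>k. \<P>(\<omega> in M. fdp_kru \<alpha> \<delta> (lord_R \<alpha> W0 (spending z \<gamma>) (\<lambda>i. p i \<omega>) k) - \<alpha> \<ge> \<epsilon>))
        \<longlonglongrightarrow> 0"
proof (intro allI impI)
  fix \<epsilon> :: real assume "\<epsilon> > 0"
  interpret online_mixture M p H \<pi>1 "gaussian_alt_cdf \<mu>" by fact
  have *: "(\<lambda>k. \<P>(\<omega> in M. e (lord_R \<alpha> W0 (spending z \<gamma>) (\<lambda>i. p i \<omega>) k) - \<alpha> \<ge> \<epsilon>)) \<longlonglongrightarrow> 0"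
    if "\<forall>\<^sub>F R in sequentially. e R < \<alpha> + \<epsilon>" for e :: "nat \<Rightarrow> real"
    using assms
    by (intro lord_R_prob_tendsto_0[where Q = "\<lambda>R. e R - \<alpha> \<ge> \<epsilon>" and \<mu> = \<mu>]
        eventually_mono[OF that]) auto
  have "\<forall>\<^sub>F R in sequentially. fdp_freed \<alpha> \<delta> R < \<alpha> + \<epsilon>"
    using assms \<open>\<epsilon> > 0\<close> by (intro order_tendstoD(2)[OF fdp_freed_tendsto]) auto
  moreover have "\<forall>\<^sub>F R in sequentially. fdp_kru \<alpha> \<delta> R < \<alpha> + \<epsilon>"
    using assms \<open>\<epsilon> > 0\<close> by (intro fdp_kru_eventually_less) auto
  ultimately show "(\<lambda>k. \<P>(\<omega> in M. fdp_freed \<alpha> \<delta> (lord_R \<alpha> W0 (spending z \<gamma>) (\<lambda>i. p i \<omega>) k) - \<alpha> \<ge> \<epsilon>))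
        \<longlonglongrightarrow> 0
    \<and> (\<lambda>k. \<P>(\<omega> in M. fdp_kru \<alpha> \<delta> (lord_R \<alpha> W0 (spending z \<gamma>) (\<lambda>i. p i \<omega>) k) - \<alpha> \<ge> \<epsilon>))
        \<longlonglongrightarrow> 0"
    using *[of "fdp_freed \<alpha> \<delta>"] *[of "fdp_kru \<alpha> \<delta>"] by blast
qed

end
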